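(* Let $G$ be a finite group of order $n$ and let ${\bf g}: g_0,\ldots,g_{n-1}$ be a terrace of $G$. Then the sequence $$g_0,g_1,\ldots,g_{n-2},g_{n-1},g_{n-1},g_{n-2},\ldots,g_1,g_0$$ is a D-sequence of $G$.
   Context: All groups are finite; $1_G$ denotes the identity of a group $G$. For a sequence ${\bf g}: g_0,\ldots,g_m$ in a group $G$ with $g_0=1_G$, the sequence of consecutive quotients ${\bf \bar g}:\bar g_0,\ldots,\bar g_m$ is defined by $\bar g_0=1_G$ and $\bar g_i=g_{i-1}^{-1}g_i$ for $1\le i\le m$. A terrace of a finite group $G$ of order $n$ is a sequence ${\bf g}: g_0,\ldots,g_{n-1}$ in $G$ with $g_0=1_G$ such that every element of $G$ appears exactly once in ${\bf g}$ and, for every $\alpha\in G$: if $\alpha^2\ne 1_G$, then $\#\{0\le i\le n-1:\bar g_i=\alpha \text{ or } \bar g_i=\alpha^{-1}\}=2$; and if $\alpha^2=1_G$, then $\#\{0\le i\le n-1:\bar g_i=\alpha\}=1$. A D-sequence of a finite group $G$ of order $n$ is a sequence ${\bf g}: g_0,\ldots,g_{2n-1}$ in $G$ with $g_0=1_G$ such that every element of $G$ appears exactly twice in each of ${\bf g}$ and ${\bf \bar g}$. *)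

theory Defs
  imports "HOL-Algebra.Coset"
begin

definition quotients :: "('a, 'b) monoid_scheme \<Rightarrow> 'a list \<Rightarrow> 'a list" where
  "quotients G gs =
     map (\<lambda>i. if i = 0 then \<one>\<^bsub>G\<^esub> else inv\<^bsub>G\<^esub> (gs ! (i - 1)) \<otimes>\<^bsub>G\<^esub> gs ! i) [0..<length gs]"

definition terrace :: "('a, 'b) monoid_scheme \<Rightarrow> 'a list \<Rightarrow> bool" where
  "terrace G gs \<longleftrightarrow>
     length gs = order G \<and>
     set gs \<subseteq> carrier G \<and>
     gs ! 0 = \<one>\<^bsub>G\<^esub> \<and>
     (\<forall>x \<in> carrier G. count_list gs x = 1) \<and>
     (\<forall>\<alpha> \<in> carrier G.
        (\<alpha> [^]\<^bsub>G\<^esub> (2::nat) \<noteq> \<one>\<^bsub>G\<^esub> \<longrightarrow>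
           card {i. i < order G \<and>
                    (quotients G gs ! i = \<alpha> \<or> quotients G gs ! i = inv\<^bsub>G\<^esub> \<alpha>)} = 2) \<and>
        (\<alpha> [^]\<^bsub>G\<^esub> (2::nat) = \<one>\<^bsub>G\<^esub> \<longrightarrow>
           card {i. i < order G \<and> quotients G gs ! i = \<alpha>} = 1))"

definition D_sequence :: "('a, 'b) monoid_scheme \<Rightarrow> 'a list \<Rightarrow> bool" where
  "D_sequence G gs \<longleftrightarrow>
     length gs = 2 * order G \<and>
     set gs \<subseteq> carrier G \<and>
     gs ! 0 = \<one>\<^bsub>G\<^esub> \<and>
     (\<forall>x \<in> carrier G. count_list gs x = 2 \<and> count_list (quotients G gs) x = 2)"

end

theory Submission
  imports Defs
begin

text \<open>
  Reading a walk backwards inverts its steps. So going along the terrace, pausing once at its last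
  element and returning gives the quotients of the terrace, then one trivial step, then the inverses
  of all quotients but the first, in reverse order. The trivial step of the pause stands in for the
  inverse of that first quotient, which is \<open>\<one>\<close> by convention. Up to order, the quotients are
  therefore those of the terrace together with all their inverses (lemma \<open>quotients_append_rev\<close>),
  and the multiplicity of \<open>\<alpha>\<close> is the sum of the multiplicities of \<open>\<alpha>\<close> and of its inverse among the
  quotients of the terrace. If \<open>\<alpha>\<close> is its own inverse, the terrace condition makes this sum
  \<open>1 + 1\<close>; otherwise the terrace condition is the statement that the sum is \<open>2\<close>.
\<close>

lemma count_list_eq_card: "count_list xs x = card {i. i < length xs \<and> xs ! i = x}"
  by (simp add: count_list_eq_length_filter length_filter_conv_card eq_commute)

lemma length_quotients [simp]: "length (quotients G gs) = length gs"
  by (simp add: quotients_def)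

lemma nth_quotients:
  "i < length gs \<Longrightarrow> quotients G gs ! i =
     (if i = 0 then \<one>\<^bsub>G\<^esub> else inv\<^bsub>G\<^esub> (gs ! (i - 1)) \<otimes>\<^bsub>G\<^esub> gs ! i)"
  by (simp add: quotients_def)

lemma quotients_eq_Cons: "gs \<noteq> [] \<Longrightarrow> quotients G gs = \<one>\<^bsub>G\<^esub> # tl (quotients G gs)"
  by (cases gs) (simp_all add: quotients_def upt_conv_Cons del: upt_Suc)

context group
begin

lemma quotients_closed: "set gs \<subseteq> carrier G \<Longrightarrow> set (quotients G gs) \<subseteq> carrier G"
  by (auto simp: quotients_def subset_iff)

text \<open>
  At the step from position \<open>i - 1\<close> to \<open>i\<close> with \<open>i > length gs\<close>, the walk goes from
  \<open>gs ! (2 * length gs - i)\<close> to its predecessor, and \<open>(a\<inverse> b)\<inverse> = b\<inverse> a\<close>.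
\<close>
lemma quotients_append_rev:
  assumes gs: "set gs \<subseteq> carrier G" and ne: "gs \<noteq> []"
  shows "quotients G (gs @ rev gs) =
    quotients G gs @ \<one> # rev (tl (map (m_inv G) (quotients G gs)))" (is "?L = ?R")
proof (rule nth_equalityI)
  let ?n = "length gs"
  have n: "?n > 0" using ne by simp
  then show "length ?L = length ?R" by simp
  have cl: "gs ! i \<in> carrier G" if "i < ?n" for i
    using gs that nth_mem by blast
  fix i assume "i < length ?L"
  then have i: "i < 2 * ?n" by simp
  consider "i < ?n" | "i = ?n" | "?n < i" by linarith
  then show "?L ! i = ?R ! i"
  proof cases
    case 1
    then show ?thesis by (auto simp: nth_quotients nth_append)
  next
    case 2
    with n have "?L ! i = inv (gs ! (?n - 1)) \<otimes> gs ! (?n - 1)"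
      by (simp add: nth_quotients nth_append rev_nth)
    also have "\<dots> = \<one>" using n by (intro l_inv cl) simp
    finally show ?thesis using 2 by (simp add: nth_append)
  next
    case 3
    define k where "k = 2 * ?n - i"
    have k: "0 < k" "k < ?n" and ik: "i = 2 * ?n - k" using 3 i by (auto simp: k_def)
    have "?L ! i = inv (gs ! k) \<otimes> gs ! (k - 1)"
    proof -
      have "(gs @ rev gs) ! (i - 1) = gs ! k" "(gs @ rev gs) ! i = gs ! (k - 1)"
        using k by (auto simp: ik nth_append rev_nth intro: arg_cong[where f = "(!) gs"])
      then show ?thesis using i 3 by (simp add: nth_quotients)
    qed
    also have "\<dots> = inv (quotients G gs ! k)"
      using k by (simp add: nth_quotients inv_mult_group cl)
    also have "\<dots> = ?R ! i"
    proof -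
      have "\<not> i < ?n" "i - ?n = Suc (?n - k - 1)" using k ik by auto
      then have "?R ! i = rev (tl (map (m_inv G) (quotients G gs))) ! (?n - k - 1)"
        by (simp add: nth_append)
      also have "\<dots> = map (m_inv G) (quotients G gs) ! k"
        using k by (simp add: rev_nth nth_tl Suc_diff_Suc)
      finally show ?thesis using k by simp
    qed
    finally show ?thesis .
  qed
qed

lemma count_list_map_inv:
  assumes "set xs \<subseteq> carrier G" "a \<in> carrier G"
  shows "count_list (map (m_inv G) xs) a = count_list xs (inv a)"
  using assms by (induction xs) auto

lemma count_list_quotients_append_rev:
  assumes gs: "set gs \<subseteq> carrier G" and ne: "gs \<noteq> []" and a: "a \<in> carrier G"
  shows "count_list (quotients G (gs @ rev gs)) a =
    count_list (quotients G gs) a + count_list (quotients G gs) (inv a)"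
proof -
  let ?q = "quotients G gs"
  have "map (m_inv G) ?q = \<one> # tl (map (m_inv G) ?q)"
    using arg_cong[OF quotients_eq_Cons[OF ne, of G], of "map (m_inv G)"] by (simp add: map_tl)
  then have "count_list (\<one> # rev (tl (map (m_inv G) ?q))) a = count_list (map (m_inv G) ?q) a"
    by (metis count_list.simps(2) count_list_rev)
  then show ?thesis
    by (simp only: quotients_append_rev[OF gs ne] count_list_append
        count_list_map_inv[OF quotients_closed[OF gs] a])
qed

end

theorem mainTheorem3:
  fixes G :: "('a, 'b) monoid_scheme" and gs :: "'a list"
  assumes "group G"
    and "finite (carrier G)"
    and "terrace G gs"
  shows "D_sequence G (gs @ rev gs)"
proof -
  interpret group G by fact
  let ?q = "quotients G gs"
  have len: "length gs = order G" and cl: "set gs \<subseteq> carrier G" and one: "gs ! 0 = \<one>\<^bsub>G\<^esub>"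
    and once: "\<And>x. x \<in> carrier G \<Longrightarrow> count_list gs x = 1"
    and ninvol: "\<And>x. x \<in> carrier G \<Longrightarrow> x [^]\<^bsub>G\<^esub> (2::nat) \<noteq> \<one>\<^bsub>G\<^esub> \<Longrightarrow>
      card {i. i < order G \<and> (?q ! i = x \<or> ?q ! i = inv\<^bsub>G\<^esub> x)} = 2"
    and invol: "\<And>x. x \<in> carrier G \<Longrightarrow> x [^]\<^bsub>G\<^esub> (2::nat) = \<one>\<^bsub>G\<^esub> \<Longrightarrow>
      card {i. i < order G \<and> ?q ! i = x} = 1"
    using assms(3) unfolding terrace_def by auto
  have ne: "gs \<noteq> []"
    using once[OF one_closed] by auto
  have "count_list (quotients G (gs @ rev gs)) x = 2" if x: "x \<in> carrier G" for x
  proof -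
    have sq: "x [^]\<^bsub>G\<^esub> (2::nat) = \<one>\<^bsub>G\<^esub> \<longleftrightarrow> inv\<^bsub>G\<^esub> x = x"
      using x by (metis inv_equality nat_pow_Suc numeral_2_eq_2 nat_pow_0 l_one l_inv)
    have "count_list ?q x + count_list ?q (inv\<^bsub>G\<^esub> x) = 2"
    proof (cases "inv\<^bsub>G\<^esub> x = x")
      case True
      then show ?thesis using invol[OF x] sq by (simp add: count_list_eq_card len)
    next
      case False
      have "{i. i < order G \<and> (?q ! i = x \<or> ?q ! i = inv\<^bsub>G\<^esub> x)} =
          {i. i < order G \<and> ?q ! i = x} \<union> {i. i < order G \<and> ?q ! i = inv\<^bsub>G\<^esub> x}"
        by auto
      moreover have "{i. i < order G \<and> ?q ! i = x} \<inter> {i. i < order G \<and> ?q ! i = inv\<^bsub>G\<^esub> x} = {}"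
        using False by auto
      ultimately show ?thesis
        using ninvol[OF x] sq False by (simp add: count_list_eq_card len card_Un_disjoint)
    qed
    then show ?thesis
      using count_list_quotients_append_rev[OF cl ne x] by simp
  qed
  then show ?thesis
    using len cl one once ne
    by (simp add: D_sequence_def nth_append flip: length_greater_0_conv)
qed

end
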